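(* Let $\phi\in L^2(\mathbb{R})$ satisfy $0<C_\phi=\int_{\mathbb{R}}\frac{|\hat\phi(\omega)|^2}{|\omega|}\,d\omega<\infty$. (i) Let $p,q>1$ and $0<\rho<1$ with $\frac1p+\frac1q=1+\rho$, and let $\psi\in L^q(\mathbb{R})$, $\phi\in L^p(\mathbb{R})$, $\chi\in L^1(\mathbb{R})$. Then for all $u\neq w$ in $\mathbb{R}$, $$\int_{\mathbb{R}}|D^\alpha(u,v,w)|\,dv\le C_\phi^{-1}\,C(p,\rho)\,|u-w|^{-\rho}\,\|\psi\|_q\,\|\phi\|_p\,\|\chi\|_1 ,$$ where $C(p,\rho)$ is a constant depending only on $p$ and $\rho$. (ii) Let $\rho\ge 1$, $\chi\in L^1(\mathbb{R})$, $(1+|x|^{\rho-1})\phi(x)\in L^1(\mathbb{R})$ and $(1+|x|^{\rho-1})\psi(x)\in L^1(\mathbb{R})$. Then for all $u\neq w$ in $\mathbb{R}$, $$\int_{\mathbb{R}}|D^\alpha(u,v,w)|\,dv\le C_\phi^{-1}\,2^{\rho-1}\,|u-w|^{-\rho}\Big[\big\|\psi(x)|x|^{\rho-1}\big\|_1\|\phi\|_1+\big\|\phi(x)|x|^{\rho-1}\big\|_1\|\psi\|_1\Big]\|\chi\|_1 .$$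
   Context: Let $\theta=\alpha\pi/2$ with $\sin\theta\ne 0$. For a function $f$ on $\mathbb{R}$ (with $f=\phi,\psi,\chi$), $a\in\mathbb{R}\setminus\{0\}$, $b\in\mathbb{R}$, put $$f^{\alpha}_{a,b}(t)=e^{-\frac{i}{2}(t^2-b^2)\cot\theta}\,|a|^{-\rho}\,f\!\left(\frac{t-b}{a}\right).$$ The basic function associated with $(\phi,\psi,\chi)$ is $$D^\alpha(u,v,w)=C_\phi^{-1}\int_{\mathbb{R}}\int_{\mathbb{R}}\overline{\psi^\alpha_{a,b}(w)}\;\overline{\chi^\alpha_{a,b}(v)}\;\phi^\alpha_{a,b}(u)\,|a|^{2\rho-3}\,da\,db .$$ The Fourier transform is $\hat\phi(\omega)=\int_{\mathbb{R}}\phi(t)e^{-i\omega t}\,dt$. *)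

theory Defs
  imports "HOL-Analysis.Analysis"
begin

text \<open>Functions on the line are complex-valued Borel functions; every class in
  \<open>L\<^sup>p(\<real>)\<close> has such a representative. \<open>Lp_norm\<close> is only meaningful together with \<open>in_Lp\<close>,
  because a divergent Bochner integral is 0.\<close>

definition in_Lp :: "real \<Rightarrow> (real \<Rightarrow> complex) \<Rightarrow> bool" where
  "in_Lp p f \<longleftrightarrow>
     f \<in> borel_measurable lborel \<and> integrable lborel (\<lambda>x. cmod (f x) powr p)"

definition Lp_norm :: "real \<Rightarrow> (real \<Rightarrow> complex) \<Rightarrow> real" where
  "Lp_norm p f = (\<integral>x. cmod (f x) powr p \<partial>lborel) powr (1 / p)"

text \<open>The Fourier transform of \<open>f \<in> L\<^sup>2\<close>: since \<open>f\<close> need not be integrable, the integral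
  \<open>\<integral> f(t) exp(-i\<omega>t) dt\<close> is taken as the limit in \<open>L\<^sup>2\<close> of the integrals over \<open>[-R, R]\<close>.
  By Plancherel the limit exists and is unique almost everywhere; \<open>fourier f\<close> is one
  representative. The distance is an extended nonnegative integral, so that
  convergence to 0 cannot hold merely by divergence of an integral.\<close>

definition truncated_fourier :: "(real \<Rightarrow> complex) \<Rightarrow> real \<Rightarrow> real \<Rightarrow> complex" where
  "truncated_fourier f R \<omega> =
     (LINT t:{-R..R}|lborel. f t * exp (- \<i> * of_real (\<omega> * t)))"

definition is_fourier_L2 :: "(real \<Rightarrow> complex) \<Rightarrow> (real \<Rightarrow> complex) \<Rightarrow> bool" where
  "is_fourier_L2 f g \<longleftrightarrow> in_Lp 2 g \<and>
     ((\<lambda>R. \<integral>\<^sup>+\<omega>. ennreal ((cmod (truncated_fourier f R \<omega> - g \<omega>))\<^sup>2) \<partial>lborel)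
        \<longlongrightarrow> 0) at_top"

definition fourier :: "(real \<Rightarrow> complex) \<Rightarrow> real \<Rightarrow> complex" where
  "fourier f = (SOME g. is_fourier_L2 f g)"

definition C_adm :: "(real \<Rightarrow> complex) \<Rightarrow> real" where
  "C_adm \<phi> = (\<integral>\<omega>. (cmod (fourier \<phi> \<omega>))\<^sup>2 / \<bar>\<omega>\<bar> \<partial>lborel)"

text \<open>\<open>0 < C_adm \<phi> < \<infinity>\<close>; finiteness is integrability.\<close>

definition admissible :: "(real \<Rightarrow> complex) \<Rightarrow> bool" where
  "admissible \<phi> \<longleftrightarrow>
     integrable lborel (\<lambda>\<omega>. (cmod (fourier \<phi> \<omega>))\<^sup>2 / \<bar>\<omega>\<bar>) \<and> 0 < C_adm \<phi>"

text \<open>\<open>frac_atom \<alpha> \<rho> f a b\<close> is \<open>f\<^sup>\<alpha>\<close> with dilation \<open>a\<close> and translation \<open>b\<close>. It is meant for \<open>a \<noteq> 0\<close>;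
  the value at \<open>a = 0\<close> only affects a null set in the integrals below.\<close>

definition frac_atom ::
  "real \<Rightarrow> real \<Rightarrow> (real \<Rightarrow> complex) \<Rightarrow> real \<Rightarrow> real \<Rightarrow> real \<Rightarrow> complex" where
  "frac_atom \<alpha> \<rho> f a b t =
     exp (- (\<i> / 2) * of_real ((t\<^sup>2 - b\<^sup>2) * cot (\<alpha> * pi / 2)))
       * of_real (\<bar>a\<bar> powr (- \<rho>)) * f ((t - b) / a)"

definition basic_integrand ::
  "real \<Rightarrow> real \<Rightarrow> (real \<Rightarrow> complex) \<Rightarrow> (real \<Rightarrow> complex) \<Rightarrow> (real \<Rightarrow> complex)
     \<Rightarrow> real \<Rightarrow> real \<Rightarrow> real \<Rightarrow> real \<Rightarrow> real \<Rightarrow> complex" where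
  "basic_integrand \<alpha> \<rho> \<phi> \<psi> chi u v w a b =
     cnj (frac_atom \<alpha> \<rho> \<psi> a b w) * cnj (frac_atom \<alpha> \<rho> chi a b v) * frac_atom \<alpha> \<rho> \<phi> a b u
       * of_real (\<bar>a\<bar> powr (2 * \<rho> - 3))"

definition basic_fun ::
  "real \<Rightarrow> real \<Rightarrow> (real \<Rightarrow> complex) \<Rightarrow> (real \<Rightarrow> complex) \<Rightarrow> (real \<Rightarrow> complex)
     \<Rightarrow> real \<Rightarrow> real \<Rightarrow> real \<Rightarrow> complex" where
  "basic_fun \<alpha> \<rho> \<phi> \<psi> chi u v w =
     of_real (inverse (C_adm \<phi>)) *
       (\<integral>b. (\<integral>a. basic_integrand \<alpha> \<rho> \<phi> \<psi> chi u v w a b \<partial>lborel) \<partial>lborel)"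

text \<open>\<open>\<integral> |D(u,v,w)| dv \<le> B\<close>, including what the left-hand side presupposes: the double
  integral defining \<open>D(u,v,w)\<close> converges absolutely for almost every \<open>v\<close>, and \<open>D(u,v,w)\<close> is
  integrable in \<open>v\<close>. Otherwise the convention that divergent integrals are 0 could make
  the inequality hold vacuously.\<close>

definition basic_L1_bound ::
  "real \<Rightarrow> real \<Rightarrow> (real \<Rightarrow> complex) \<Rightarrow> (real \<Rightarrow> complex) \<Rightarrow> (real \<Rightarrow> complex)
     \<Rightarrow> real \<Rightarrow> real \<Rightarrow> real \<Rightarrow> bool" where
  "basic_L1_bound \<alpha> \<rho> \<phi> \<psi> chi u w B \<longleftrightarrow>
     (AE v in lborel.
        integrable (lborel \<Otimes>\<^sub>M lborel) (\<lambda>(a, b). basic_integrand \<alpha> \<rho> \<phi> \<psi> chi u v w a b)) \<and>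
     integrable lborel (\<lambda>v. basic_fun \<alpha> \<rho> \<phi> \<psi> chi u v w) \<and>
     (\<integral>v. cmod (basic_fun \<alpha> \<rho> \<phi> \<psi> chi u v w) \<partial>lborel) \<le> B"

end

theory Submission
  imports Defs
begin

text \<open>The chirp factors have modulus one. Integrating first over \<open>v\<close> and then substituting
  \<open>x = (w - b) / a\<close>, \<open>y = (u - b) / a\<close> (so that \<open>a = (u - w) / (y - x)\<close>), Tonelli's theorem turns the
  integral of the modulus of the basic integrand over \<open>a\<close>, \<open>b\<close>, \<open>v\<close> into
  \<open>\<bar>u - w\<bar> powr (- \<rho>)\<close> times \<open>\<parallel>\<chi>\<parallel>\<^sub>1\<close> times
  \<open>\<integral>\<integral> \<bar>\<psi> x\<bar> \<bar>\<phi> y\<bar> \<bar>y - x\<bar> powr (\<rho> - 1) dx dy\<close>.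
  For \<open>\<rho> \<ge> 1\<close> the kernel is at most \<open>2 powr (\<rho> - 1) * (\<bar>x\<bar> powr (\<rho> - 1) + \<bar>y\<bar> powr (\<rho> - 1))\<close>.
  For \<open>0 < \<rho> < 1\<close> the bound is the Hardy--Littlewood--Sobolev inequality on the line.\<close>

subsection \<open>Integrals on the line\<close>

lemma nn_integral_reflect:
  fixes f :: "real \<Rightarrow> ennreal"
  assumes [measurable]: "f \<in> borel_measurable borel"
  shows "(\<integral>\<^sup>+x. f (- x) \<partial>lborel) = (\<integral>\<^sup>+x. f x \<partial>lborel)"
  using nn_integral_real_affine[of f "-1" 0] by simp

text \<open>The point 0 is a null set and the negative half line reflects onto the positive one.
  This reduces even power integrals and the substitution \<open>1 / x\<close> to the positive half
  line, where interval calculus applies.\<close>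

lemma nn_integral_split_at_0:
  fixes f :: "real \<Rightarrow> ennreal"
  assumes [measurable]: "f \<in> borel_measurable borel"
  shows "(\<integral>\<^sup>+x. f x \<partial>lborel) =
    (\<integral>\<^sup>+x. f x * indicator {0<..} x \<partial>lborel) + (\<integral>\<^sup>+x. f (- x) * indicator {0<..} x \<partial>lborel)"
proof -
  have "(\<integral>\<^sup>+x. f x \<partial>lborel) = (\<integral>\<^sup>+x. f x * indicator {0<..} x + f x * indicator {..<0} x \<partial>lborel)"
    by (rule nn_integral_cong_AE, use AE_lborel_singleton[of "0::real"] in eventually_elim)
       (auto split: split_indicator)
  also have "\<dots> = (\<integral>\<^sup>+x. f x * indicator {0<..} x \<partial>lborel) + (\<integral>\<^sup>+x. f x * indicator {..<0} x \<partial>lborel)"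
    by (rule nn_integral_add) auto
  also have "(\<integral>\<^sup>+x. f x * indicator {..<0} x \<partial>lborel)
      = (\<integral>\<^sup>+x. f (- x) * indicator {..<0} (- x) \<partial>lborel)"
    by (rule nn_integral_reflect[symmetric]) auto
  also have "\<dots> = (\<integral>\<^sup>+x. f (- x) * indicator {0<..} x \<partial>lborel)"
    by (rule nn_integral_cong) (auto split: split_indicator)
  finally show ?thesis .
qed

section \<open>Power integrals on a neighbourhood of 0 and of infinity\<close>

lemma nn_integral_powr_near_0:
  fixes e r :: real
  assumes "e > -1" "r > 0"
  shows "(\<integral>\<^sup>+x. ennreal (\<bar>x\<bar> powr e * indicator {..r} \<bar>x\<bar>) \<partial>lborel) = ennreal (2 * r powr (e + 1) / (e + 1))"
proof -
  have "(\<integral>\<^sup>+x. ennreal (\<bar>x\<bar> powr e * indicator {..r} \<bar>x\<bar>) * indicator {0<..} x \<partial>lborel)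
     = (\<integral>\<^sup>+x. ennreal (indicator {0..r} x * x powr e) \<partial>lborel)"
    by (rule nn_integral_cong) (auto split: split_indicator)
  also have "\<dots> = ennreal (r powr (e + 1) / (e + 1))"
    using nn_integral_has_integral_lebesgue[OF _ has_integral_powr_from_0[of e r]] assms by simp
  finally have *: "(\<integral>\<^sup>+x. ennreal (\<bar>x\<bar> powr e * indicator {..r} \<bar>x\<bar>) * indicator {0<..} x \<partial>lborel)
     = ennreal (r powr (e + 1) / (e + 1))" .
  show ?thesis
    by (subst nn_integral_split_at_0) (use assms * in \<open>simp_all flip: ennreal_plus\<close>)
qed

lemma nn_integral_powr_near_infinity:
  fixes e r :: real
  assumes "e < -1" "r > 0"
  shows "(\<integral>\<^sup>+x. ennreal (\<bar>x\<bar> powr e * indicator {r..} \<bar>x\<bar>) \<partial>lborel) = ennreal (2 * r powr (e + 1) / (- e - 1))"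
proof -
  have "(\<integral>\<^sup>+x. ennreal (\<bar>x\<bar> powr e * indicator {r..} \<bar>x\<bar>) * indicator {0<..} x \<partial>lborel)
     = (\<integral>\<^sup>+x. ennreal (indicator {r..} x * x powr e) \<partial>lborel)"
    using assms by (intro nn_integral_cong) (auto split: split_indicator)
  also have "\<dots> = ennreal (r powr (e + 1) / (- e - 1))"
    using nn_integral_has_integral_lebesgue[OF _ has_integral_powr_to_inf[of e r]] assms
      minus_divide_right[of "r powr (e + 1)" "e + 1"] by simp
  finally have *: "(\<integral>\<^sup>+x. ennreal (\<bar>x\<bar> powr e * indicator {r..} \<bar>x\<bar>) * indicator {0<..} x \<partial>lborel)
     = ennreal (r powr (e + 1) / (- e - 1))" .
  show ?thesis
    by (subst nn_integral_split_at_0) (use assms * in \<open>simp_all flip: ennreal_plus\<close>)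
qed

text \<open>The substitution rule is available for a nondecreasing map on a compact interval,
  whereas \<open>1 / x\<close> is decreasing and singular at 0. Hence the half line is exhausted by
  compact intervals away from 0, and on each of them the inversion is composed with a
  reflection.\<close>

lemma nn_integral_inverse_substitution_pos:
  fixes f :: "real \<Rightarrow> real"
  assumes [measurable]: "f \<in> borel_measurable borel" and nonneg: "\<And>x. 0 \<le> f x"
  shows "(\<integral>\<^sup>+x. ennreal (f x) * indicator {0<..} x \<partial>lborel)
    = (\<integral>\<^sup>+x. ennreal (f (1 / x) / x\<^sup>2) * indicator {0<..} x \<partial>lborel)"
proof -
  \<comment> \<open>Each \<open>I n\<close> is mapped onto itself by \<open>1 / x\<close>, so the
    domain of integration is the same before and after the substitution.\<close>
  define I where "I n = {1 / (real n + 1) .. real n + 1}" for n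
  \<comment> \<open>Monotone convergence, read as continuity from below of the measure with density
    \<open>h\<close>.\<close>
  have I_exhausts: "(\<integral>\<^sup>+x. h x * indicator {0<..} x \<partial>lborel) = (SUP n. \<integral>\<^sup>+x. h x * indicator (I n) x \<partial>lborel)"
    if [measurable]: "h \<in> borel_measurable borel" for h :: "real \<Rightarrow> ennreal"
  proof -
    have mono: "incseq I"
      unfolding I_def incseq_def by (auto intro: frac_le)
    have "x \<in> (\<Union>n. I n)" if "x > 0" for x
    proof -
      obtain n where "max x (1 / x) \<le> real n" using real_arch_simple by blast
      then have "x \<in> I n" using that
        by (auto simp: I_def field_simps)
      then show ?thesis by blast
    qed
    moreover have "I n \<subseteq> {0<..}" for n
      unfolding I_def by (auto intro: less_le_trans[of 0 "1 / (real n + 1)"])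
    ultimately have UN: "{0<..} = (\<Union>n. I n)" by blast
    have [measurable]: "I n \<in> sets borel" for n by (simp add: I_def)
    show ?thesis
      using SUP_emeasure_incseq[of I "density lborel h"] mono unfolding UN
      by (simp add: emeasure_density image_subset_iff)
  qed
  have "(\<integral>\<^sup>+x. ennreal (f x) * indicator (I n) x \<partial>lborel)
      = (\<integral>\<^sup>+x. ennreal (f (1 / x) / x\<^sup>2) * indicator (I n) x \<partial>lborel)" for n
  proof -
    \<comment> \<open>Reflecting first leaves the map \<open>- (1 / x)\<close>, whose derivative
      \<open>1 / x\<^sup>2\<close> is nonnegative.\<close>
    have "(\<integral>\<^sup>+x. ennreal (f x) * indicator (I n) x \<partial>lborel)
        = (\<integral>\<^sup>+x. ennreal (f (- x)) * indicator (I n) (- x) \<partial>lborel)"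
      by (rule nn_integral_reflect[symmetric]) (simp add: I_def)
    also have "\<dots> = (\<integral>\<^sup>+x. ennreal (f (- x) * indicator {- (1 / (1 / (real n + 1))) .. - (1 / (real n + 1))} x) \<partial>lborel)"
      by (rule nn_integral_cong) (auto simp: I_def split: split_indicator)
    also have "\<dots> = (\<integral>\<^sup>+x. f (- (- (1 / x))) * (1 / x\<^sup>2) * indicator {1 / (real n + 1) .. real n + 1} x \<partial>lborel)"
    proof (subst nn_integral_substitution[of "\<lambda>x. - (1 / x)" "1 / (real n + 1)" "real n + 1" "\<lambda>x. f (- x)" "\<lambda>x. 1 / x\<^sup>2"])
      have pos: "0 < x" if "x \<in> {1 / (real n + 1)..real n + 1}" for x
        using that by (auto intro: less_le_trans[of 0 "1 / (real n + 1)"])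
      show "((\<lambda>x. - (1 / x)) has_real_derivative 1 / x\<^sup>2) (at x)"
        if "x \<in> {1 / (real n + 1)..real n + 1}" for x
        using pos[OF that] by (auto intro!: derivative_eq_intros simp: power2_eq_square)
      show "continuous_on {1 / (real n + 1)..real n + 1} (\<lambda>x. 1 / x\<^sup>2)"
        using pos by (force intro!: continuous_intros)
      show "1 / (real n + 1) \<le> real n + 1"
        by (simp add: field_simps)
    qed (auto simp: set_borel_measurable_def)
    also have "\<dots> = (\<integral>\<^sup>+x. ennreal (f (1 / x) / x\<^sup>2) * indicator (I n) x \<partial>lborel)"
      by (rule nn_integral_cong) (auto simp: I_def split: split_indicator)
    finally show ?thesis .
  qed
  then show ?thesis
    by (subst (1 2) I_exhausts) auto
qed

lemma nn_integral_inverse_substitution: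
  fixes f :: "real \<Rightarrow> real"
  assumes [measurable]: "f \<in> borel_measurable borel" and nonneg: "\<And>x. 0 \<le> f x"
  shows "(\<integral>\<^sup>+x. ennreal (f x) \<partial>lborel) = (\<integral>\<^sup>+x. ennreal (f (1 / x) / x\<^sup>2) \<partial>lborel)"
  using nn_integral_inverse_substitution_pos[of f] nn_integral_inverse_substitution_pos[of "\<lambda>x. f (- x)"] nonneg
  by (subst (1 2) nn_integral_split_at_0) auto

subsection \<open>The Hardy--Littlewood--Sobolev inequality\<close>

text \<open>The three summands are the contributions in the truncated estimate below:
  \<open>2 / \<rho>\<close> from the kernel near its singularity, 1 from the p-th power of the
  function, and \<open>2 * (p - 1) / (1 - p * \<rho>)\<close> from the tail of the kernel.\<close>

definition hls_const :: "real \<Rightarrow> real \<Rightarrow> real" where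
  "hls_const p \<rho> = 2 / \<rho> + 1 + 2 * (p - 1) / (1 - p * \<rho>)"

text \<open>Split at distance \<open>r\<close> from \<open>x\<close>. Nearby, \<open>g\<close> is
  replaced by its bound \<open>B\<close> and the kernel is integrable because \<rho> is positive;
  far away, Young's inequality separates \<open>g\<close> from the kernel, whose conjugate power is
  integrable at infinity because \<open>p * \<rho> < 1\<close>. For the chosen radius both parts are
  multiples of \<open>B powr (1 - p * \<rho>)\<close>.\<close>

lemma nn_integral_truncated_riesz_kernel_le:
  fixes g :: "real \<Rightarrow> real" and p \<rho> B x :: real
  assumes [measurable]: "g \<in> borel_measurable borel"
    and nonneg: "\<And>y. 0 \<le> g y"
    and p: "1 < p" and rho: "0 < \<rho>" "p * \<rho> < 1" and B: "0 < B"
    and norm: "(\<integral>\<^sup>+y. ennreal (g y powr p) \<partial>lborel) \<le> 1"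
  shows "(\<integral>\<^sup>+y. ennreal (g y * \<bar>y - x\<bar> powr (\<rho> - 1)) * indicator {y. g y \<le> B} y \<partial>lborel)
    \<le> ennreal (hls_const p \<rho> * B powr (1 - p * \<rho>))"
proof -
  \<comment> \<open>the radius at which the two estimates of the integrand balance\<close>
  define r where "r = B powr (- p)"
  \<comment> \<open>\<open>p'\<close> is the conjugate exponent of \<open>p\<close>, and
    \<open>- s\<close> is the exponent of the kernel raised to the power \<open>p'\<close>. The
    condition \<open>s > 1\<close>, needed for the tail to converge, is a restatement of
    \<open>p * \<rho> < 1\<close>.\<close>
  define p' where "p' = p / (p - 1)"
  define s where "s = (1 - \<rho>) * p'"
  have r: "r > 0" using B by (simp add: r_def)
  have "p * (1 - \<rho>) > p - 1" using rho by (simp add: algebra_simps)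
  then have s: "s > 1" and s_minus_1: "s - 1 = (1 - p * \<rho>) / (p - 1)"
    using p by (simp_all add: s_def p'_def field_simps)
  have p': "p' > 1" "1 / p + 1 / p' = 1" using p by (simp_all add: p'_def field_simps)
  have far: "g y * \<bar>z\<bar> powr (\<rho> - 1)
      \<le> r powr (\<rho> - 1 / p) * (g y powr p + r powr (s - 1) * \<bar>z\<bar> powr (- s))" for y z
  proof -
    \<comment> \<open>The power of \<open>r\<close> normalises the kernel: the integral of
      \<open>h powr p'\<close> over distances at least \<open>r\<close> is
      \<open>2 / (s - 1)\<close>, whatever \<open>r\<close> is. The factor compensating for it is
      \<open>K\<close> below.\<close>
    define h where "h = \<bar>z\<bar> powr (\<rho> - 1) * r powr (1 / p - \<rho>)"
    have h_p': "h powr p' = r powr (s - 1) * \<bar>z\<bar> powr (- s)"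
    proof -
      have "(1 / p - \<rho>) * p' = s - 1" using p unfolding s_minus_1 p'_def by (simp add: field_simps)
      moreover have "(\<rho> - 1) * p' = - s" by (simp add: s_def algebra_simps)
      ultimately show ?thesis by (simp add: h_def powr_mult powr_powr mult.commute)
    qed
    have "g y * h \<le> g y powr p / p + h powr p' / p'"
      by (rule Youngs_inequality) (use p p' nonneg in \<open>auto simp: h_def\<close>)
    \<comment> \<open>The weights \<open>1 / p\<close> and \<open>1 / p'\<close> are at most 1;
      dropping them only enlarges the constant.\<close>
    also have "\<dots> \<le> g y powr p + h powr p'"
      by (intro add_mono) (use p p' in \<open>auto simp: divide_le_eq mult_le_cancel_left1\<close>)
    finally have "r powr (\<rho> - 1 / p) * (g y * h) \<le> r powr (\<rho> - 1 / p) * (g y powr p + h powr p')"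
      by (intro mult_left_mono) auto
    moreover have "r powr (\<rho> - 1 / p) * r powr (1 / p - \<rho>) = 1"
      using r by (simp flip: powr_add)
    ultimately show ?thesis unfolding h_p' by (simp add: h_def mult_ac)
  qed
  define near where "near z = ennreal (\<bar>z\<bar> powr (\<rho> - 1) * indicator {..r} \<bar>z\<bar>)" for z :: real
  define tail where "tail z = ennreal (\<bar>z\<bar> powr (- s) * indicator {r..} \<bar>z\<bar>)" for z :: real
  have [measurable]: "near \<in> borel_measurable borel" "tail \<in> borel_measurable borel"
    unfolding near_def tail_def by measurable
  define K where "K = r powr (\<rho> - 1 / p)"
  have K: "K \<ge> 0" by (simp add: K_def)
  have le: "ennreal (g y * \<bar>y - x\<bar> powr (\<rho> - 1)) * indicator {y. g y \<le> B} y
      \<le> ennreal B * near (y - x) + (ennreal K * ennreal (g y powr p)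
          + ennreal (K * r powr (s - 1)) * tail (y - x))" for y
  proof (cases "g y \<le> B")
    case True
    show ?thesis
    proof (cases "\<bar>y - x\<bar> \<le> r")
      case True
      with \<open>g y \<le> B\<close> have "ennreal (g y * \<bar>y - x\<bar> powr (\<rho> - 1)) \<le> ennreal B * near (y - x)"
        using B by (auto simp: near_def intro!: mult_right_mono ennreal_leI simp flip: ennreal_mult)
      then show ?thesis using \<open>g y \<le> B\<close> by (auto intro: add_increasing2)
    next
      case False
      have "ennreal (g y * \<bar>y - x\<bar> powr (\<rho> - 1))
          \<le> ennreal (K * (g y powr p + r powr (s - 1) * \<bar>y - x\<bar> powr (- s)))"
        unfolding K_def by (rule ennreal_leI[OF far])
      also have "\<dots> = ennreal K * ennreal (g y powr p) + ennreal (K * r powr (s - 1)) * tail (y - x)"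
        using False K by (simp add: tail_def algebra_simps flip: ennreal_mult ennreal_plus)
      finally show ?thesis using \<open>g y \<le> B\<close> by (auto intro: add_increasing)
    qed
  qed simp
  have shift: "(\<integral>\<^sup>+y. h (y - x) \<partial>lborel) = (\<integral>\<^sup>+y. h y \<partial>lborel)"
    if [measurable]: "h \<in> borel_measurable borel" for h :: "real \<Rightarrow> ennreal"
    using nn_integral_real_affine[of h 1 "- x"] by (simp add: add.commute)
  have "(\<integral>\<^sup>+y. ennreal (g y * \<bar>y - x\<bar> powr (\<rho> - 1)) * indicator {y. g y \<le> B} y \<partial>lborel)
      \<le> (\<integral>\<^sup>+y. ennreal B * near (y - x) + (ennreal K * ennreal (g y powr p)
          + ennreal (K * r powr (s - 1)) * tail (y - x)) \<partial>lborel)"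
    by (rule nn_integral_mono) (rule le)
  also have "\<dots> = ennreal B * (\<integral>\<^sup>+y. near y \<partial>lborel) + (ennreal K * (\<integral>\<^sup>+y. ennreal (g y powr p) \<partial>lborel)
          + ennreal (K * r powr (s - 1)) * (\<integral>\<^sup>+y. tail y \<partial>lborel))"
    by (simp add: nn_integral_add nn_integral_cmult shift)
  also have "\<dots> \<le> ennreal B * ennreal (2 * r powr \<rho> / \<rho>) + (ennreal K * 1
          + ennreal (K * r powr (s - 1)) * ennreal (2 * r powr (1 - s) / (s - 1)))"
    using nn_integral_powr_near_0[of "\<rho> - 1" r] nn_integral_powr_near_infinity[of "- s" r] rho s r norm
    by (intro add_mono mult_left_mono) (auto simp: near_def tail_def)
  also have "\<dots> = ennreal (B * (2 * r powr \<rho> / \<rho>) + (K + (K * r powr (s - 1)) * (2 * r powr (1 - s) / (s - 1))))"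
    using B K s rho by (simp flip: ennreal_mult ennreal_plus)
  also have "B * (2 * r powr \<rho> / \<rho>) + (K + (K * r powr (s - 1)) * (2 * r powr (1 - s) / (s - 1)))
      = 2 / \<rho> * (B * r powr \<rho>) + K + 2 / (s - 1) * K * (r powr (s - 1) * r powr (1 - s))"
    by (simp add: field_simps)
  also have "r powr (s - 1) * r powr (1 - s) = 1"
    using r by (simp flip: powr_add)
  also have "B * r powr \<rho> = B powr (1 - p * \<rho>)"
    using B powr_add[of B 1 "- (p * \<rho>)"] unfolding r_def powr_powr by simp
  also have "K = B powr (1 - p * \<rho>)"
    using p by (simp add: K_def r_def powr_powr algebra_simps)
  finally show ?thesis
    using p by (simp add: hls_const_def s_minus_1 algebra_simps)
qed

text \<open>With both norms at most 1, compare the two factors: where \<open>g\<^sup>p \<le> f\<^sup>q\<close>, the inner integral over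
  \<open>y\<close> is at most a multiple of \<open>f(x)\<^bsup>q-1\<^esup>\<close> by the truncated estimate at height \<open>f(x)\<^bsup>q/p\<^esup>\<close>.\<close>

lemma sobolev_exponent_less_1:
  fixes p q \<rho> :: real
  assumes "1 < p" "1 < q" "1 / p + 1 / q = 1 + \<rho>"
  shows "p * \<rho> < 1"
proof -
  have "1 / q < 1" using assms by simp
  then have "\<rho> < 1 / p" using assms by linarith
  then show ?thesis using assms by (simp add: field_simps)
qed

lemma hls_const_nonneg: "1 \<le> p \<Longrightarrow> 0 < \<rho> \<Longrightarrow> p * \<rho> < 1 \<Longrightarrow> 0 \<le> hls_const p \<rho>"
  by (simp add: hls_const_def)

lemma hardy_littlewood_sobolev_half:
  fixes f g :: "real \<Rightarrow> real" and p q \<rho> :: real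
  assumes [measurable]: "f \<in> borel_measurable borel" "g \<in> borel_measurable borel"
    and nonneg: "\<And>x. 0 \<le> f x" "\<And>x. 0 \<le> g x"
    and pq: "1 < p" "1 < q" "0 < \<rho>" "1 / p + 1 / q = 1 + \<rho>"
    and norm_f: "(\<integral>\<^sup>+x. ennreal (f x powr q) \<partial>lborel) \<le> 1"
    and norm_g: "(\<integral>\<^sup>+x. ennreal (g x powr p) \<partial>lborel) \<le> 1"
  shows "(\<integral>\<^sup>+x. (\<integral>\<^sup>+y. ennreal (f x * g y * \<bar>y - x\<bar> powr (\<rho> - 1))
      * indicator {y. g y \<le> f x powr (q / p)} y \<partial>lborel) \<partial>lborel) \<le> ennreal (hls_const p \<rho>)"
proof -
  have prho: "p * \<rho> < 1" using pq by (intro sobolev_exponent_less_1[of p q])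
  have const: "hls_const p \<rho> \<ge> 0" using pq prho by (simp add: hls_const_nonneg)
  \<comment> \<open>This identity dictates the height \<open>f x powr (q / p)\<close>: the outer
    factor \<open>f x\<close> and the power produced by the truncated estimate combine to exactly
    \<open>f x powr q\<close>, which is integrable.\<close>
  have exponent: "1 + q / p * (1 - p * \<rho>) = q"
  proof -
    have "q / p * (1 - p * \<rho>) = q * (1 / p - \<rho>)" using pq by (simp add: field_simps)
    also have "1 / p - \<rho> = 1 - 1 / q" using pq by simp
    finally show ?thesis using pq by (simp add: field_simps)
  qed
  have inner: "(\<integral>\<^sup>+y. ennreal (f x * g y * \<bar>y - x\<bar> powr (\<rho> - 1))
      * indicator {y. g y \<le> f x powr (q / p)} y \<partial>lborel)
      \<le> ennreal (hls_const p \<rho>) * ennreal (f x powr q)" for x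
  proof (cases "f x = 0")
    \<comment> \<open>The truncated estimate needs a positive height; where \<open>f x\<close> is 0
      the integrand vanishes.\<close>
    case False
    then have pos: "f x > 0" using nonneg(1)[of x] by simp
    have "(\<integral>\<^sup>+y. ennreal (f x * g y * \<bar>y - x\<bar> powr (\<rho> - 1)) * indicator {y. g y \<le> f x powr (q / p)} y \<partial>lborel)
        = (\<integral>\<^sup>+y. ennreal (f x) * (ennreal (g y * \<bar>y - x\<bar> powr (\<rho> - 1))
            * indicator {y. g y \<le> f x powr (q / p)} y) \<partial>lborel)"
      using nonneg by (intro nn_integral_cong) (simp add: ennreal_mult mult_ac)
    also have "\<dots> = ennreal (f x) * (\<integral>\<^sup>+y. ennreal (g y * \<bar>y - x\<bar> powr (\<rho> - 1))
            * indicator {y. g y \<le> f x powr (q / p)} y \<partial>lborel)"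
      by (rule nn_integral_cmult) measurable
    also have "\<dots> \<le> ennreal (f x) * ennreal (hls_const p \<rho> * (f x powr (q / p)) powr (1 - p * \<rho>))"
      by (intro mult_left_mono nn_integral_truncated_riesz_kernel_le) (use pq prho pos nonneg norm_g in auto)
    also have "\<dots> = ennreal (hls_const p \<rho>) * ennreal (f x powr 1 * f x powr (q / p * (1 - p * \<rho>)))"
      using const nonneg by (simp add: powr_powr ennreal_mult mult_ac)
    also have "f x powr 1 * f x powr (q / p * (1 - p * \<rho>)) = f x powr q"
      by (simp only: exponent flip: powr_add)
    finally show ?thesis .
  qed simp
  have "(\<integral>\<^sup>+x. (\<integral>\<^sup>+y. ennreal (f x * g y * \<bar>y - x\<bar> powr (\<rho> - 1))
      * indicator {y. g y \<le> f x powr (q / p)} y \<partial>lborel) \<partial>lborel)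
      \<le> (\<integral>\<^sup>+x. ennreal (hls_const p \<rho>) * ennreal (f x powr q) \<partial>lborel)"
    by (rule nn_integral_mono) (rule inner)
  also have "\<dots> = ennreal (hls_const p \<rho>) * (\<integral>\<^sup>+x. ennreal (f x powr q) \<partial>lborel)"
    by (rule nn_integral_cmult) measurable
  also have "\<dots> \<le> ennreal (hls_const p \<rho>) * 1"
    by (intro mult_left_mono norm_f) simp
  finally show ?thesis by simp
qed

text \<open>The regions \<open>g y powr p \<le> f x powr q\<close> and its reverse cover the plane.
  The exponent relation is symmetric and the kernel is even, so the second region is the first with
  \<open>(f, q)\<close> and \<open>(g, p)\<close> exchanged. This is why the constants for
  \<open>p\<close> and for \<open>q\<close> are added.\<close>

lemma hardy_littlewood_sobolev_unit:
  fixes f g :: "real \<Rightarrow> real" and p q \<rho> :: real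
  assumes [measurable]: "f \<in> borel_measurable borel" "g \<in> borel_measurable borel"
    and nonneg: "\<And>x. 0 \<le> f x" "\<And>x. 0 \<le> g x"
    and pq: "1 < p" "1 < q" "0 < \<rho>" "1 / p + 1 / q = 1 + \<rho>"
    and norm_f: "(\<integral>\<^sup>+x. ennreal (f x powr q) \<partial>lborel) \<le> 1"
    and norm_g: "(\<integral>\<^sup>+x. ennreal (g x powr p) \<partial>lborel) \<le> 1"
  shows "(\<integral>\<^sup>+x. (\<integral>\<^sup>+y. ennreal (f x * g y * \<bar>y - x\<bar> powr (\<rho> - 1)) \<partial>lborel) \<partial>lborel)
    \<le> ennreal (hls_const p \<rho>) + ennreal (hls_const q \<rho>)"
proof -
  define k where "k x y = ennreal (f x * g y * \<bar>y - x\<bar> powr (\<rho> - 1))" for x y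
  have [measurable]: "case_prod k \<in> borel_measurable (borel \<Otimes>\<^sub>M borel)"
    unfolding k_def by measurable
  have "k x y \<le> k x y * indicator {y. g y \<le> f x powr (q / p)} y + k x y * indicator {x. f x \<le> g y powr (p / q)} x"
    for x y
  proof (cases "g y \<le> f x powr (q / p)")
    case False
    then have "(f x powr (q / p)) powr (p / q) \<le> g y powr (p / q)"
      using pq by (intro powr_mono2) auto
    then have "f x \<le> g y powr (p / q)"
      using pq nonneg by (simp add: powr_powr)
    then show ?thesis by simp
  qed simp
  then have "(\<integral>\<^sup>+x. (\<integral>\<^sup>+y. k x y \<partial>lborel) \<partial>lborel)
      \<le> (\<integral>\<^sup>+x. (\<integral>\<^sup>+y. k x y * indicator {y. g y \<le> f x powr (q / p)} y
            + k x y * indicator {x. f x \<le> g y powr (p / q)} x \<partial>lborel) \<partial>lborel)"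
    by (intro nn_integral_mono)
  also have "\<dots> = (\<integral>\<^sup>+x. (\<integral>\<^sup>+y. k x y * indicator {y. g y \<le> f x powr (q / p)} y \<partial>lborel) \<partial>lborel)
        + (\<integral>\<^sup>+x. (\<integral>\<^sup>+y. k x y * indicator {x. f x \<le> g y powr (p / q)} x \<partial>lborel) \<partial>lborel)"
    by (simp add: nn_integral_add)
  \<comment> \<open>Tonelli makes the variable of the truncated function the inner one, as the half
    estimate requires.\<close>
  also have "(\<integral>\<^sup>+x. (\<integral>\<^sup>+y. k x y * indicator {x. f x \<le> g y powr (p / q)} x \<partial>lborel) \<partial>lborel)
      = (\<integral>\<^sup>+y. (\<integral>\<^sup>+x. k x y * indicator {x. f x \<le> g y powr (p / q)} x \<partial>lborel) \<partial>lborel)"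
    by (rule lborel_pair.Fubini'[symmetric]) measurable
  also have "\<dots> \<le> ennreal (hls_const q \<rho>)"
    using hardy_littlewood_sobolev_half[of g f q p \<rho>] assms
    by (simp add: k_def mult.commute[of "f _"] abs_minus_commute add.commute)
  also have "(\<integral>\<^sup>+x. (\<integral>\<^sup>+y. k x y * indicator {y. g y \<le> f x powr (q / p)} y \<partial>lborel) \<partial>lborel)
      \<le> ennreal (hls_const p \<rho>)"
    unfolding k_def by (rule hardy_littlewood_sobolev_half) (use assms in auto)
  finally show ?thesis unfolding k_def by (simp add: add_mono)
qed

text \<open>Both sides are homogeneous of degree one in each function, so dividing by the norms
  \<open>F\<close> and \<open>G\<close> reduces to the normalised case.\<close>

lemma hardy_littlewood_sobolev:
  fixes f g :: "real \<Rightarrow> real" and p q \<rho> F G :: real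
  assumes [measurable]: "f \<in> borel_measurable borel" "g \<in> borel_measurable borel"
    and nonneg: "\<And>x. 0 \<le> f x" "\<And>x. 0 \<le> g x"
    and pq: "1 < p" "1 < q" "0 < \<rho>" "1 / p + 1 / q = 1 + \<rho>"
    and norm_f: "(\<integral>\<^sup>+x. ennreal (f x powr q) \<partial>lborel) = ennreal (F powr q)" "0 \<le> F"
    and norm_g: "(\<integral>\<^sup>+x. ennreal (g x powr p) \<partial>lborel) = ennreal (G powr p)" "0 \<le> G"
  shows "(\<integral>\<^sup>+x. (\<integral>\<^sup>+y. ennreal (f x * g y * \<bar>y - x\<bar> powr (\<rho> - 1)) \<partial>lborel) \<partial>lborel)
    \<le> ennreal ((hls_const p \<rho> + hls_const q \<rho>) * F * G)"
proof -
  \<comment> \<open>A zero norm rules out the division, but then the function is 0 almost everywhere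
    and so is the integrand.\<close>
  have vanish: "AE x in lborel. h x = 0"
    if [measurable]: "h \<in> borel_measurable borel" and "(\<integral>\<^sup>+x. ennreal (h x powr e) \<partial>lborel) = ennreal (0 powr e)"
    for h :: "real \<Rightarrow> real" and e
    using that(2) by (simp add: nn_integral_0_iff_AE powr_nonneg_iff)
  consider "F = 0" | "G = 0" | "F > 0" "G > 0" using norm_f norm_g by linarith
  then show ?thesis
  proof cases
    case 1
    with vanish[of f q] norm_f have "AE x in lborel. f x = 0" by simp
    then have "AE x in lborel. (\<integral>\<^sup>+y. ennreal (f x * g y * \<bar>y - x\<bar> powr (\<rho> - 1)) \<partial>lborel) = 0"
      by eventually_elim simp
    then show ?thesis by (subst nn_integral_cong_AE) auto
  next
    case 2
    with vanish[of g p] norm_g have "AE y in lborel. g y = 0" by simp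
    then have "AE y in lborel. ennreal (f x * g y * \<bar>y - x\<bar> powr (\<rho> - 1)) = 0" for x
      by eventually_elim simp
    then have "(\<integral>\<^sup>+y. ennreal (f x * g y * \<bar>y - x\<bar> powr (\<rho> - 1)) \<partial>lborel) = 0" for x
      by (subst nn_integral_cong_AE[where v = "\<lambda>_. 0"]) auto
    then show ?thesis by simp
  next
    case 3
    have unit: "(\<integral>\<^sup>+x. ennreal ((h x / H) powr e) \<partial>lborel) \<le> 1"
      if [measurable]: "h \<in> borel_measurable borel"
        and h: "\<And>x. 0 \<le> h x" "(\<integral>\<^sup>+x. ennreal (h x powr e) \<partial>lborel) = ennreal (H powr e)" "0 < H"
      for h :: "real \<Rightarrow> real" and H e
    proof -
      have "(\<integral>\<^sup>+x. ennreal ((h x / H) powr e) \<partial>lborel) = (\<integral>\<^sup>+x. ennreal (inverse (H powr e)) * ennreal (h x powr e) \<partial>lborel)"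
        using h by (intro nn_integral_cong) (simp add: powr_divide field_simps flip: ennreal_mult)
      also have "\<dots> = ennreal (inverse (H powr e)) * ennreal (H powr e)"
        by (subst nn_integral_cmult) (use h in auto)
      finally show ?thesis using h by (simp flip: ennreal_mult)
    qed
    define S where "S = (\<integral>\<^sup>+x. (\<integral>\<^sup>+y. ennreal (f x / F * (g y / G) * \<bar>y - x\<bar> powr (\<rho> - 1)) \<partial>lborel) \<partial>lborel)"
    have "S \<le> ennreal (hls_const p \<rho>) + ennreal (hls_const q \<rho>)"
      unfolding S_def
      by (rule hardy_littlewood_sobolev_unit[of "\<lambda>x. f x / F" "\<lambda>x. g x / G" p q])
         (use pq nonneg 3 norm_f norm_g in \<open>auto intro!: unit\<close>)
    moreover have "hls_const p \<rho> \<ge> 0" "hls_const q \<rho> \<ge> 0"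
      using pq sobolev_exponent_less_1[of p q \<rho>] sobolev_exponent_less_1[of q p \<rho>]
      by (simp_all add: hls_const_nonneg add.commute)
    ultimately have "S \<le> ennreal (hls_const p \<rho> + hls_const q \<rho>)" by simp
    then have "ennreal (F * G) * S \<le> ennreal (F * G) * ennreal (hls_const p \<rho> + hls_const q \<rho>)"
      by (rule mult_left_mono) simp
    also have "\<dots> = ennreal ((hls_const p \<rho> + hls_const q \<rho>) * F * G)"
      using 3 \<open>hls_const p \<rho> \<ge> 0\<close> \<open>hls_const q \<rho> \<ge> 0\<close> by (simp add: mult_ac flip: ennreal_mult ennreal_plus)
    also have "ennreal (F * G) * S
        = (\<integral>\<^sup>+x. (\<integral>\<^sup>+y. ennreal (f x * g y * \<bar>y - x\<bar> powr (\<rho> - 1)) \<partial>lborel) \<partial>lborel)"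
      unfolding S_def using 3 nonneg
      by (simp add: nn_integral_cmult[symmetric] flip: ennreal_mult)
    finally show ?thesis .
  qed
qed

subsection \<open>The basic function\<close>

lemma borel_measurable_cnj [measurable]: "cnj \<in> borel_measurable borel"
  by (intro borel_measurable_continuous_onI continuous_intros)

lemma frac_atom_measurable [measurable]:
  assumes [measurable]: "f \<in> borel_measurable borel" "a \<in> borel_measurable M" "b \<in> borel_measurable M"
    "t \<in> borel_measurable M"
  shows "(\<lambda>x. frac_atom \<alpha> \<rho> f (a x) (b x) (t x)) \<in> borel_measurable M"
  unfolding frac_atom_def by measurable

lemma basic_integrand_measurable [measurable]:
  assumes [measurable]: "\<phi> \<in> borel_measurable borel" "\<psi> \<in> borel_measurable borel"
    "chi \<in> borel_measurable borel" "a \<in> borel_measurable M" "b \<in> borel_measurable M" "v \<in> borel_measurable M"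
  shows "(\<lambda>x. basic_integrand \<alpha> \<rho> \<phi> \<psi> chi u (v x) w (a x) (b x)) \<in> borel_measurable M"
  unfolding basic_integrand_def by measurable

lemma cmod_frac_atom: "cmod (frac_atom \<alpha> \<rho> f a b t) = \<bar>a\<bar> powr (- \<rho>) * cmod (f ((t - b) / a))"
  by (simp add: frac_atom_def norm_mult norm_exp_eq_Re)

lemma cmod_basic_integrand:
  "cmod (basic_integrand \<alpha> \<rho> \<phi> \<psi> chi u v w a b) =
     \<bar>a\<bar> powr (- \<rho> - 3) * cmod (\<psi> ((w - b) / a)) * cmod (\<phi> ((u - b) / a)) * cmod (chi ((v - b) / a))"
proof -
  have "\<bar>a\<bar> powr (- \<rho>) * \<bar>a\<bar> powr (- \<rho>) * \<bar>a\<bar> powr (- \<rho>) * \<bar>a\<bar> powr (2 * \<rho> - 3) = \<bar>a\<bar> powr (- \<rho> - 3)"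
    by (simp flip: powr_add)
  then show ?thesis
    by (simp add: basic_integrand_def norm_mult cmod_frac_atom mult_ac)
qed

section \<open>Changes of variable in the translation and dilation parameters\<close>

lemma nn_integral_rescale:
  fixes f :: "real \<Rightarrow> ennreal" and a b :: real
  assumes [measurable]: "f \<in> borel_measurable borel" and "a \<noteq> 0"
  shows "(\<integral>\<^sup>+v. f ((v - b) / a) \<partial>lborel) = ennreal \<bar>a\<bar> * (\<integral>\<^sup>+v. f v \<partial>lborel)"
  using nn_integral_real_affine[of "\<lambda>v. f ((v - b) / a)" a b] assms(2) by simp

text \<open>This is the substitution \<open>y = x + d / a\<close> in three moves: scale by
  \<open>d\<close>, invert, translate. The scaling Jacobian turns
  \<open>\<bar>d\<bar> powr (- \<rho> - 1)\<close> into
  \<open>\<bar>d\<bar> powr (- \<rho>)\<close>, and the inversion Jacobian turns the exponent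
  \<open>- \<rho> - 1\<close> into \<open>\<rho> - 1\<close>.\<close>

lemma nn_integral_inverse_dilation:
  fixes g :: "real \<Rightarrow> real" and d x \<rho> :: real
  assumes [measurable]: "g \<in> borel_measurable borel" and nonneg: "\<And>y. 0 \<le> g y" and d: "d \<noteq> 0"
  shows "(\<integral>\<^sup>+a. ennreal (\<bar>a\<bar> powr (- \<rho> - 1) * g (x + d / a)) \<partial>lborel)
    = ennreal (\<bar>d\<bar> powr (- \<rho>)) * (\<integral>\<^sup>+y. ennreal (g y * \<bar>y - x\<bar> powr (\<rho> - 1)) \<partial>lborel)"
proof -
  have dpow: "\<bar>d\<bar> * \<bar>d\<bar> powr (- \<rho> - 1) = \<bar>d\<bar> powr (- \<rho>)"
    using d powr_add[of "\<bar>d\<bar>" 1 "- \<rho> - 1"] by simp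
  have "(\<integral>\<^sup>+a. ennreal (\<bar>a\<bar> powr (- \<rho> - 1) * g (x + d / a)) \<partial>lborel)
      = ennreal \<bar>d\<bar> * (\<integral>\<^sup>+t. ennreal (\<bar>d * t\<bar> powr (- \<rho> - 1) * g (x + d / (d * t))) \<partial>lborel)"
    using nn_integral_real_affine[of "\<lambda>a. ennreal (\<bar>a\<bar> powr (- \<rho> - 1) * g (x + d / a))" d 0] d by simp
  also have "(\<integral>\<^sup>+t. ennreal (\<bar>d * t\<bar> powr (- \<rho> - 1) * g (x + d / (d * t))) \<partial>lborel)
      = (\<integral>\<^sup>+t. ennreal (\<bar>d\<bar> powr (- \<rho> - 1)) * ennreal (\<bar>t\<bar> powr (- \<rho> - 1) * g (x + 1 / t)) \<partial>lborel)"
    using d nonneg by (intro nn_integral_cong) (simp add: abs_mult powr_mult mult.assoc flip: ennreal_mult)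
  also have "\<dots> = ennreal (\<bar>d\<bar> powr (- \<rho> - 1)) * (\<integral>\<^sup>+t. ennreal (\<bar>t\<bar> powr (- \<rho> - 1) * g (x + 1 / t)) \<partial>lborel)"
    by (rule nn_integral_cmult) measurable
  also have "ennreal \<bar>d\<bar> * \<dots> = ennreal (\<bar>d\<bar> powr (- \<rho>)) * (\<integral>\<^sup>+t. ennreal (\<bar>t\<bar> powr (- \<rho> - 1) * g (x + 1 / t)) \<partial>lborel)"
    by (simp add: dpow flip: mult.assoc ennreal_mult)
  also have "(\<integral>\<^sup>+t. ennreal (\<bar>t\<bar> powr (- \<rho> - 1) * g (x + 1 / t)) \<partial>lborel)
      = (\<integral>\<^sup>+t. ennreal (\<bar>1 / t\<bar> powr (\<rho> - 1) * g (x + 1 / t) / t\<^sup>2) \<partial>lborel)"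
  proof (rule nn_integral_cong)
    fix t :: real
    \<comment> \<open>The identity holds at \<open>t = 0\<close> too, since \<open>0 powr\<close>
      anything and division by 0 are both 0.\<close>
    have "\<bar>t\<bar> powr (- \<rho> - 1) = \<bar>1 / t\<bar> powr (\<rho> - 1) / t\<^sup>2"
    proof (cases "t = 0")
      case False
      have "\<bar>1 / t\<bar> powr (\<rho> - 1) / t\<^sup>2 = \<bar>t\<bar> powr (1 - \<rho>) / \<bar>t\<bar> powr 2"
        using False by (simp add: powr_divide powr_diff field_simps)
      also have "\<dots> = \<bar>t\<bar> powr ((1 - \<rho>) - 2)"
        by (simp only: powr_diff)
      also have "(1 - \<rho>) - 2 = - \<rho> - 1" by simp
      finally show ?thesis by (rule sym)
    qed simp
    then show "ennreal (\<bar>t\<bar> powr (- \<rho> - 1) * g (x + 1 / t)) = ennreal (\<bar>1 / t\<bar> powr (\<rho> - 1) * g (x + 1 / t) / t\<^sup>2)"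
      by simp
  qed
  also have "\<dots> = (\<integral>\<^sup>+s. ennreal (\<bar>s\<bar> powr (\<rho> - 1) * g (x + s)) \<partial>lborel)"
    by (rule nn_integral_inverse_substitution[of "\<lambda>s. \<bar>s\<bar> powr (\<rho> - 1) * g (x + s)", symmetric]) (use nonneg in auto)
  also have "\<dots> = (\<integral>\<^sup>+y. ennreal (g y * \<bar>y - x\<bar> powr (\<rho> - 1)) \<partial>lborel)"
    using nn_integral_real_affine[of "\<lambda>y. ennreal (g y * \<bar>y - x\<bar> powr (\<rho> - 1))" 1 x] by (simp add: mult.commute)
  finally show ?thesis .
qed

text \<open>The planar change of variables is carried out as two one-dimensional ones with Tonelli
  in between: \<open>b = w - a * x\<close> at fixed \<open>a\<close>, then \<open>a\<close> to
  \<open>y\<close> at fixed \<open>x\<close>. Being an equality in extended nonnegative reals, it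
  presupposes no convergence.\<close>

lemma nn_integral_basic_integrand:
  fixes \<phi> \<psi> chi :: "real \<Rightarrow> complex"
  assumes [measurable]: "\<phi> \<in> borel_measurable borel" "\<psi> \<in> borel_measurable borel"
    "chi \<in> borel_measurable borel"
    and "u \<noteq> w"
  shows "(\<integral>\<^sup>+v. (\<integral>\<^sup>+b. (\<integral>\<^sup>+a. ennreal (cmod (basic_integrand \<alpha> \<rho> \<phi> \<psi> chi u v w a b)) \<partial>lborel) \<partial>lborel) \<partial>lborel)
    = ennreal (\<bar>u - w\<bar> powr (- \<rho>))
      * (\<integral>\<^sup>+x. (\<integral>\<^sup>+y. ennreal (cmod (\<psi> x) * cmod (\<phi> y) * \<bar>y - x\<bar> powr (\<rho> - 1)) \<partial>lborel) \<partial>lborel)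
      * (\<integral>\<^sup>+v. ennreal (cmod (chi v)) \<partial>lborel)"
proof -
  define N where "N = (\<integral>\<^sup>+v. ennreal (cmod (chi v)) \<partial>lborel)"
  define h where "h a b = \<bar>a\<bar> powr (- \<rho> - 3) * cmod (\<psi> ((w - b) / a)) * cmod (\<phi> ((u - b) / a))" for a b
  define h' where "h' x a = cmod (\<psi> x) * (\<bar>a\<bar> powr (- \<rho> - 1) * cmod (\<phi> (x + (u - w) / a)))" for x a
  have [measurable]: "case_prod h \<in> borel_measurable (borel \<Otimes>\<^sub>M borel)" "case_prod h' \<in> borel_measurable (borel \<Otimes>\<^sub>M borel)"
    unfolding h_def h'_def by measurable
  have h_nonneg: "h a b \<ge> 0" for a b by (simp add: h_def)
  \<comment> \<open>Both vanish at \<open>a = 0\<close> because \<open>0 powr\<close> anything is 0,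
    so the identities below hold for every \<open>a\<close>, without an exceptional null
    set.\<close>
  have [simp]: "h 0 b = 0" "h' x 0 = 0" for b x by (simp_all add: h_def h'_def)
  \<comment> \<open>The factor \<open>\<bar>a\<bar>\<close> on the left comes from rescaling
    \<open>v\<close>; the substitution \<open>b = w - a * x\<close> supplies another. Together they
    raise the exponent from \<open>- \<rho> - 3\<close> to \<open>- \<rho> - 1\<close>.\<close>
  have h_h': "ennreal \<bar>a\<bar> * (\<integral>\<^sup>+b. ennreal (h a b) \<partial>lborel) = (\<integral>\<^sup>+x. ennreal (h' x a) \<partial>lborel)" for a
  proof (cases "a = 0")
    case False
    have "(\<integral>\<^sup>+b. ennreal (h a b) \<partial>lborel) = ennreal \<bar>a\<bar> * (\<integral>\<^sup>+x. ennreal (h a (w - a * x)) \<partial>lborel)"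
      using nn_integral_real_affine[of "\<lambda>b. ennreal (h a b)" "- a" w] False by simp
    then have "ennreal \<bar>a\<bar> * (\<integral>\<^sup>+b. ennreal (h a b) \<partial>lborel)
        = (\<integral>\<^sup>+x. ennreal (a\<^sup>2) * ennreal (h a (w - a * x)) \<partial>lborel)"
      by (simp add: nn_integral_cmult power2_eq_square flip: mult.assoc ennreal_mult)
    also have "\<dots> = (\<integral>\<^sup>+x. ennreal (h' x a) \<partial>lborel)"
    proof (rule nn_integral_cong)
      fix x
      have "a\<^sup>2 = \<bar>a\<bar> powr 2" using False by simp
      have "a\<^sup>2 * \<bar>a\<bar> powr (- \<rho> - 3) = \<bar>a\<bar> powr (2 + (- \<rho> - 3))"
        by (simp only: powr_add \<open>a\<^sup>2 = \<bar>a\<bar> powr 2\<close>)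
      also have "2 + (- \<rho> - 3) = - \<rho> - 1" by simp
      finally have "a\<^sup>2 * \<bar>a\<bar> powr (- \<rho> - 3) = \<bar>a\<bar> powr (- \<rho> - 1)" .
      moreover have "(u - (w - a * x)) / a = x + (u - w) / a" "(w - (w - a * x)) / a = x"
        using False by (simp_all add: field_simps)
      ultimately have "a\<^sup>2 * h a (w - a * x) = h' x a"
        by (simp add: h_def h'_def mult.assoc[symmetric])
      then show "ennreal (a\<^sup>2) * ennreal (h a (w - a * x)) = ennreal (h' x a)"
        using h_nonneg by (simp flip: ennreal_mult)
    qed
    finally show ?thesis .
  qed simp
  have "(\<integral>\<^sup>+v. (\<integral>\<^sup>+b. (\<integral>\<^sup>+a. ennreal (cmod (basic_integrand \<alpha> \<rho> \<phi> \<psi> chi u v w a b)) \<partial>lborel) \<partial>lborel) \<partial>lborel)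
      = (\<integral>\<^sup>+b. (\<integral>\<^sup>+v. (\<integral>\<^sup>+a. ennreal (cmod (basic_integrand \<alpha> \<rho> \<phi> \<psi> chi u v w a b)) \<partial>lborel) \<partial>lborel) \<partial>lborel)"
    by (rule lborel_pair.Fubini') measurable
  also have "\<dots> = (\<integral>\<^sup>+b. (\<integral>\<^sup>+a. (\<integral>\<^sup>+v. ennreal (cmod (basic_integrand \<alpha> \<rho> \<phi> \<psi> chi u v w a b)) \<partial>lborel) \<partial>lborel) \<partial>lborel)"
    by (intro nn_integral_cong lborel_pair.Fubini') measurable
  also have "\<dots> = (\<integral>\<^sup>+b. (\<integral>\<^sup>+a. ennreal \<bar>a\<bar> * ennreal (h a b) * N \<partial>lborel) \<partial>lborel)"
  proof (intro nn_integral_cong)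
    fix a b :: real
    have "(\<integral>\<^sup>+v. ennreal (cmod (basic_integrand \<alpha> \<rho> \<phi> \<psi> chi u v w a b)) \<partial>lborel)
       = (\<integral>\<^sup>+v. ennreal (h a b) * ennreal (cmod (chi ((v - b) / a))) \<partial>lborel)"
      using h_nonneg by (simp add: cmod_basic_integrand h_def ennreal_mult)
    also have "\<dots> = ennreal (h a b) * (\<integral>\<^sup>+v. ennreal (cmod (chi ((v - b) / a))) \<partial>lborel)"
      by (rule nn_integral_cmult) measurable
    also have "\<dots> = ennreal \<bar>a\<bar> * ennreal (h a b) * N"
      using nn_integral_rescale[of "\<lambda>v. ennreal (cmod (chi v))" a b]
      by (cases "a = 0") (simp_all add: N_def mult_ac)
    finally show "(\<integral>\<^sup>+v. ennreal (cmod (basic_integrand \<alpha> \<rho> \<phi> \<psi> chi u v w a b)) \<partial>lborel)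
       = ennreal \<bar>a\<bar> * ennreal (h a b) * N" .
  qed
  also have "\<dots> = (\<integral>\<^sup>+a. (\<integral>\<^sup>+b. ennreal \<bar>a\<bar> * ennreal (h a b) * N \<partial>lborel) \<partial>lborel)"
    by (rule lborel_pair.Fubini') measurable
  also have "\<dots> = (\<integral>\<^sup>+a. (\<integral>\<^sup>+x. ennreal (h' x a) \<partial>lborel) * N \<partial>lborel)"
    by (simp add: nn_integral_cmult nn_integral_multc h_h')
  also have "\<dots> = (\<integral>\<^sup>+a. (\<integral>\<^sup>+x. ennreal (h' x a) \<partial>lborel) \<partial>lborel) * N"
    by (rule nn_integral_multc) measurable
  \<comment> \<open>With \<open>x\<close> outermost, the integral over \<open>a\<close> at fixed
    \<open>x\<close> has the form treated by the inverse dilation.\<close>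
  also have "(\<integral>\<^sup>+a. (\<integral>\<^sup>+x. ennreal (h' x a) \<partial>lborel) \<partial>lborel) = (\<integral>\<^sup>+x. (\<integral>\<^sup>+a. ennreal (h' x a) \<partial>lborel) \<partial>lborel)"
    by (rule lborel_pair.Fubini') measurable
  also have "\<dots> = (\<integral>\<^sup>+x. ennreal (\<bar>u - w\<bar> powr (- \<rho>)) *
        (\<integral>\<^sup>+y. ennreal (cmod (\<psi> x) * cmod (\<phi> y) * \<bar>y - x\<bar> powr (\<rho> - 1)) \<partial>lborel) \<partial>lborel)"
  proof (rule nn_integral_cong)
    fix x
    have "(\<integral>\<^sup>+a. ennreal (h' x a) \<partial>lborel)
        = ennreal (cmod (\<psi> x)) * (\<integral>\<^sup>+a. ennreal (\<bar>a\<bar> powr (- \<rho> - 1) * cmod (\<phi> (x + (u - w) / a))) \<partial>lborel)"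
      unfolding h'_def by (simp add: ennreal_mult nn_integral_cmult)
    also have "\<dots> = ennreal (cmod (\<psi> x)) * (ennreal (\<bar>u - w\<bar> powr (- \<rho>))
        * (\<integral>\<^sup>+y. ennreal (cmod (\<phi> y) * \<bar>y - x\<bar> powr (\<rho> - 1)) \<partial>lborel))"
      using \<open>u \<noteq> w\<close> by (subst nn_integral_inverse_dilation) auto
    also have "\<dots> = ennreal (\<bar>u - w\<bar> powr (- \<rho>)) *
        (\<integral>\<^sup>+y. ennreal (cmod (\<psi> x)) * ennreal (cmod (\<phi> y) * \<bar>y - x\<bar> powr (\<rho> - 1)) \<partial>lborel)"
      by (simp add: nn_integral_cmult mult_ac)
    finally show "(\<integral>\<^sup>+a. ennreal (h' x a) \<partial>lborel) = ennreal (\<bar>u - w\<bar> powr (- \<rho>)) *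
        (\<integral>\<^sup>+y. ennreal (cmod (\<psi> x) * cmod (\<phi> y) * \<bar>y - x\<bar> powr (\<rho> - 1)) \<partial>lborel)"
      by (simp add: mult.assoc flip: ennreal_mult)
  qed
  also have "\<dots> = ennreal (\<bar>u - w\<bar> powr (- \<rho>)) * (\<integral>\<^sup>+x.
        (\<integral>\<^sup>+y. ennreal (cmod (\<psi> x) * cmod (\<phi> y) * \<bar>y - x\<bar> powr (\<rho> - 1)) \<partial>lborel) \<partial>lborel)"
    by (rule nn_integral_cmult) measurable
  finally show ?thesis by (simp add: N_def)
qed

text \<open>Integrability is not assumed: a divergent Bochner integral is 0. The bound can therefore
  be applied to the iterated integral defining the basic function without first showing that the
  inner integrals converge.\<close>

lemma ennreal_norm_integral_le:
  fixes f :: "'a \<Rightarrow> 'b :: {banach, second_countable_topology}"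
  shows "ennreal (norm (\<integral>x. f x \<partial>M)) \<le> (\<integral>\<^sup>+x. ennreal (norm (f x)) \<partial>M)"
  by (cases "integrable M f") (simp_all add: integral_norm_bound_ennreal not_integrable_integral_eq)

section \<open>Norms as nonnegative integrals, and the passage from a kernel bound to the basic
  function\<close>

lemma in_Lp_1_iff: "in_Lp 1 f \<longleftrightarrow> integrable lborel f"
  unfolding in_Lp_def by (auto simp: integrable_norm_iff)

lemma Lp_norm_1: "Lp_norm 1 f = (\<integral>x. cmod (f x) \<partial>lborel)"
  by (simp add: Lp_norm_def)

lemma Lp_norm_nonneg: "0 \<le> Lp_norm p f"
  by (simp add: Lp_norm_def)

lemma nn_integral_Lp_norm:
  assumes "in_Lp p f" "0 < p"
  shows "(\<integral>\<^sup>+x. ennreal (cmod (f x) powr p) \<partial>lborel) = ennreal (Lp_norm p f powr p)"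
  using assms unfolding in_Lp_def Lp_norm_def
  by (simp add: nn_integral_eq_integral powr_powr)

text \<open>Common to both ranges of \<rho>, which differ only in how \<open>K\<close> is obtained.
  A single finite integral of absolute values gives all three clauses of
  \<open>basic_L1_bound\<close>: absolute convergence for almost every \<open>v\<close>,
  integrability in \<open>v\<close>, and the bound.\<close>

lemma basic_L1_bound_if_kernel_bound:
  fixes \<phi> \<psi> chi :: "real \<Rightarrow> complex"
  assumes meas [measurable]: "\<phi> \<in> borel_measurable borel" "\<psi> \<in> borel_measurable borel"
    and chi: "in_Lp 1 chi"
    and adm: "admissible \<phi>" and uw: "u \<noteq> w" and K: "0 \<le> K"
    and kernel: "(\<integral>\<^sup>+x. (\<integral>\<^sup>+y. ennreal (cmod (\<psi> x) * cmod (\<phi> y) * \<bar>y - x\<bar> powr (\<rho> - 1)) \<partial>lborel) \<partial>lborel) \<le> ennreal K"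
  shows "basic_L1_bound \<alpha> \<rho> \<phi> \<psi> chi u w (inverse (C_adm \<phi>) * \<bar>u - w\<bar> powr (- \<rho>) * K * Lp_norm 1 chi)"
proof -
  have [measurable]: "chi \<in> borel_measurable borel"
    using chi by (simp add: in_Lp_def)
  let ?F = "\<lambda>v a b. basic_integrand \<alpha> \<rho> \<phi> \<psi> chi u v w a b"
  let ?D = "\<lambda>v. basic_fun \<alpha> \<rho> \<phi> \<psi> chi u v w"
  define T where "T v = (\<integral>\<^sup>+b. (\<integral>\<^sup>+a. ennreal (cmod (?F v a b)) \<partial>lborel) \<partial>lborel)" for v
  have [measurable]: "T \<in> borel_measurable borel" unfolding T_def by measurable
  define B where "B = \<bar>u - w\<bar> powr (- \<rho>) * K * Lp_norm 1 chi"
  have C: "0 < C_adm \<phi>" using adm by (simp add: admissible_def)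
  have "(\<integral>\<^sup>+v. ennreal (cmod (chi v)) \<partial>lborel) = ennreal (Lp_norm 1 chi)"
    using nn_integral_Lp_norm[OF chi] Lp_norm_nonneg[of 1 chi] by simp
  then have T: "(\<integral>\<^sup>+v. T v \<partial>lborel) \<le> ennreal B"
    unfolding T_def B_def nn_integral_basic_integrand[OF meas \<open>chi \<in> _\<close> uw]
    using K kernel by (auto simp: ennreal_mult Lp_norm_nonneg intro!: mult_mono)
  \<comment> \<open>A function with finite integral is finite almost everywhere, and finiteness of
    \<open>T v\<close> is absolute convergence of the double integral at \<open>v\<close>.\<close>
  have "AE v in lborel. T v \<noteq> \<infinity>"
    by (rule nn_integral_PInf_AE) (use T in \<open>auto simp: top_unique\<close>)
  then have "AE v in lborel. integrable (lborel \<Otimes>\<^sub>M lborel) (\<lambda>(a, b). ?F v a b)"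
  proof eventually_elim
    case (elim v)
    \<comment> \<open>Tonelli on the product with the first component \<open>a\<close> as inner
      variable, which is the order used in \<open>T\<close>.\<close>
    have "(\<integral>\<^sup>+z. ennreal (cmod (case z of (a, b) \<Rightarrow> ?F v a b)) \<partial>(lborel \<Otimes>\<^sub>M lborel)) = T v"
      unfolding T_def by (subst lborel_pair.nn_integral_snd[symmetric]) (auto simp: case_prod_beta)
    with elim show ?case
      by (intro integrableI_bounded) (auto simp: less_top)
  qed
  \<comment> \<open>This holds for every \<open>v\<close>, even where \<open>T v\<close> is
    infinite. Positivity of \<open>C_adm \<phi>\<close> allows its inverse to be taken out of the
    modulus.\<close>
  moreover have D_le: "ennreal (cmod (?D v)) \<le> ennreal (inverse (C_adm \<phi>)) * T v" for v
  proof -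
    have "ennreal (cmod (\<integral>b. (\<integral>a. ?F v a b \<partial>lborel) \<partial>lborel)) \<le> T v"
      unfolding T_def
      by (rule order_trans[OF ennreal_norm_integral_le]) (intro nn_integral_mono ennreal_norm_integral_le)
    then show ?thesis
      using C by (simp add: basic_fun_def norm_mult ennreal_mult norm_inverse mult_left_mono)
  qed
  have D_bound: "(\<integral>\<^sup>+v. ennreal (cmod (?D v)) \<partial>lborel) \<le> ennreal (inverse (C_adm \<phi>) * B)"
  proof -
    have "(\<integral>\<^sup>+v. ennreal (cmod (?D v)) \<partial>lborel) \<le> (\<integral>\<^sup>+v. ennreal (inverse (C_adm \<phi>)) * T v \<partial>lborel)"
      by (rule nn_integral_mono) (rule D_le)
    also have "\<dots> = ennreal (inverse (C_adm \<phi>)) * (\<integral>\<^sup>+v. T v \<partial>lborel)"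
      by (rule nn_integral_cmult) measurable
    also have "\<dots> \<le> ennreal (inverse (C_adm \<phi>)) * ennreal B"
      by (intro mult_left_mono T) simp
    finally show ?thesis
      using C K by (simp add: B_def Lp_norm_nonneg ennreal_mult)
  qed
  have [measurable]: "?D \<in> borel_measurable borel"
    unfolding basic_fun_def by measurable
  moreover have "integrable lborel ?D"
    by (rule integrableI_bounded) (use D_bound in \<open>auto intro: le_less_trans\<close>)
  moreover have "(\<integral>v. cmod (?D v) \<partial>lborel) \<le> inverse (C_adm \<phi>) * B"
    using D_bound nn_integral_eq_integral[OF integrable_norm[OF \<open>integrable lborel ?D\<close>]] C K
    by (simp add: B_def Lp_norm_nonneg)
  ultimately show ?thesis
    unfolding basic_L1_bound_def B_def by (simp add: mult.assoc)
qed

section \<open>The kernel for \<rho> \<ge> 1 and weighted integrability\<close>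

lemma abs_diff_powr_le:
  fixes x y \<rho> :: real
  assumes "1 \<le> \<rho>"
  shows "\<bar>y - x\<bar> powr (\<rho> - 1) \<le> 2 powr (\<rho> - 1) * (\<bar>x\<bar> powr (\<rho> - 1) + \<bar>y\<bar> powr (\<rho> - 1))"
proof -
  \<comment> \<open>The distance is at most twice the larger modulus and the exponent is
    nonnegative; afterwards the power of the maximum is one of the two summands.\<close>
  have "\<bar>y - x\<bar> powr (\<rho> - 1) \<le> (2 * max \<bar>x\<bar> \<bar>y\<bar>) powr (\<rho> - 1)"
    by (cases "x = y") (use assms in \<open>auto intro!: powr_mono2\<close>)
  also have "\<dots> = 2 powr (\<rho> - 1) * max \<bar>x\<bar> \<bar>y\<bar> powr (\<rho> - 1)"
    by (simp add: powr_mult)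
  also have "\<dots> \<le> 2 powr (\<rho> - 1) * (\<bar>x\<bar> powr (\<rho> - 1) + \<bar>y\<bar> powr (\<rho> - 1))"
    by (intro mult_left_mono) (auto simp: max_def)
  finally show ?thesis .
qed

text \<open>The weight \<open>1 + \<bar>x\<bar> powr e\<close> dominates both 1 and
  \<open>\<bar>x\<bar> powr e\<close>, so the weighted function dominates each of the two.\<close>

lemma integrable_weightedD:
  fixes f :: "real \<Rightarrow> complex" and e :: real
  assumes "in_Lp 1 (\<lambda>x. of_real (1 + \<bar>x\<bar> powr e) * f x)"
  shows "integrable lborel f" "integrable lborel (\<lambda>x. f x * of_real (\<bar>x\<bar> powr e))"
proof -
  let ?g = "\<lambda>x. of_real (1 + \<bar>x\<bar> powr e) * f x"
  have g: "integrable lborel ?g" using assms by (simp add: in_Lp_1_iff)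
  have ne: "complex_of_real (1 + \<bar>x\<bar> powr e) \<noteq> 0" for x
    unfolding of_real_eq_0_iff using powr_ge_zero[of "\<bar>x\<bar>" e] by linarith
  \<comment> \<open>Measurability is known for the weighted function; it passes to \<open>f\<close>
    on dividing by the weight, which is at least 1.\<close>
  have "(\<lambda>x. ?g x / of_real (1 + \<bar>x\<bar> powr e)) \<in> borel_measurable lborel"
    using g by measurable
  then have [measurable]: "f \<in> borel_measurable borel" using ne by simp
  have norm_g: "cmod (?g x) = cmod (f x) + cmod (f x) * \<bar>x\<bar> powr e" for x
    by (simp only: norm_mult norm_of_real) (simp add: algebra_simps)
  show "integrable lborel f"
    by (rule Bochner_Integration.integrable_bound[OF g], measurable, rule AE_I2, subst norm_g, simp)
  show "integrable lborel (\<lambda>x. f x * of_real (\<bar>x\<bar> powr e))"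
    by (rule Bochner_Integration.integrable_bound[OF g], measurable, rule AE_I2, subst norm_g, simp add: norm_mult)
qed

text \<open>Once the kernel is bounded by a sum of a power of \<open>x\<close> and a power of
  \<open>y\<close>, the integrand becomes a sum of two products with separated variables, and each
  double integral factors into two norms.\<close>

lemma weighted_kernel_bound:
  fixes f g :: "real \<Rightarrow> complex" and \<rho> :: real
  assumes rho: "1 \<le> \<rho>"
    and f: "integrable lborel f" "integrable lborel (\<lambda>x. f x * of_real (\<bar>x\<bar> powr (\<rho> - 1)))"
    and g: "integrable lborel g" "integrable lborel (\<lambda>x. g x * of_real (\<bar>x\<bar> powr (\<rho> - 1)))"
  shows "(\<integral>\<^sup>+x. (\<integral>\<^sup>+y. ennreal (cmod (f x) * cmod (g y) * \<bar>y - x\<bar> powr (\<rho> - 1)) \<partial>lborel) \<partial>lborel)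
    \<le> ennreal (2 powr (\<rho> - 1) *
        (Lp_norm 1 (\<lambda>x. f x * of_real (\<bar>x\<bar> powr (\<rho> - 1))) * Lp_norm 1 g
          + Lp_norm 1 (\<lambda>x. g x * of_real (\<bar>x\<bar> powr (\<rho> - 1))) * Lp_norm 1 f))"
proof -
  have [measurable]: "f \<in> borel_measurable borel" "g \<in> borel_measurable borel"
    using f(1) g(1) by (auto dest: borel_measurable_integrable)
  let ?f' = "\<lambda>x. f x * of_real (\<bar>x\<bar> powr (\<rho> - 1))" and ?g' = "\<lambda>x. g x * of_real (\<bar>x\<bar> powr (\<rho> - 1))"
  have N: "(\<integral>\<^sup>+x. ennreal (cmod (h x)) \<partial>lborel) = ennreal (Lp_norm 1 h)" if "integrable lborel h" for h
    using nn_integral_Lp_norm[of 1 h] that Lp_norm_nonneg[of 1 h] by (simp add: in_Lp_1_iff)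
  have "ennreal (cmod (f x) * cmod (g y) * \<bar>y - x\<bar> powr (\<rho> - 1))
      \<le> ennreal (2 powr (\<rho> - 1)) * (ennreal (cmod (?f' x)) * ennreal (cmod (g y))
          + ennreal (cmod (f x)) * ennreal (cmod (?g' y)))" for x y
  proof -
    have "cmod (f x) * cmod (g y) * \<bar>y - x\<bar> powr (\<rho> - 1)
        \<le> cmod (f x) * cmod (g y) * (2 powr (\<rho> - 1) * (\<bar>x\<bar> powr (\<rho> - 1) + \<bar>y\<bar> powr (\<rho> - 1)))"
      by (intro mult_left_mono abs_diff_powr_le rho) simp
    also have "\<dots> = 2 powr (\<rho> - 1) * (cmod (?f' x) * cmod (g y) + cmod (f x) * cmod (?g' y))"
      by (simp add: norm_mult algebra_simps)
    finally show ?thesis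
      by (simp add: ennreal_leI flip: ennreal_mult ennreal_plus)
  qed
  then have "(\<integral>\<^sup>+x. (\<integral>\<^sup>+y. ennreal (cmod (f x) * cmod (g y) * \<bar>y - x\<bar> powr (\<rho> - 1)) \<partial>lborel) \<partial>lborel)
    \<le> (\<integral>\<^sup>+x. (\<integral>\<^sup>+y. ennreal (2 powr (\<rho> - 1)) * (ennreal (cmod (?f' x)) * ennreal (cmod (g y))
          + ennreal (cmod (f x)) * ennreal (cmod (?g' y))) \<partial>lborel) \<partial>lborel)"
    by (intro nn_integral_mono)
  also have "\<dots> = ennreal (2 powr (\<rho> - 1)) * (ennreal (Lp_norm 1 ?f') * ennreal (Lp_norm 1 g)
          + ennreal (Lp_norm 1 f) * ennreal (Lp_norm 1 ?g'))"
    by (simp add: nn_integral_cmult nn_integral_multc nn_integral_add N[OF f(1)] N[OF f(2)] N[OF g(1)] N[OF g(2)])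
  also have "\<dots> = ennreal (2 powr (\<rho> - 1) * (Lp_norm 1 ?f' * Lp_norm 1 g + Lp_norm 1 ?g' * Lp_norm 1 f))"
    by (simp add: Lp_norm_nonneg mult.commute flip: ennreal_mult ennreal_plus)
  finally show ?thesis .
qed

theorem theorem3p4:
  shows "(\<exists>C :: real \<Rightarrow> real \<Rightarrow> real.
           \<forall>(p::real) (q::real) (\<rho>::real) (\<alpha>::real)
             (\<phi> :: real \<Rightarrow> complex) (\<psi> :: real \<Rightarrow> complex) (chi :: real \<Rightarrow> complex).
             sin (\<alpha> * pi / 2) \<noteq> 0 \<longrightarrow>
             in_Lp 2 \<phi> \<longrightarrow> admissible \<phi> \<longrightarrow>
             1 < p \<longrightarrow> 1 < q \<longrightarrow> 0 < \<rho> \<longrightarrow> \<rho> < 1 \<longrightarrow> 1 / p + 1 / q = 1 + \<rho> \<longrightarrow>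
             in_Lp q \<psi> \<longrightarrow> in_Lp p \<phi> \<longrightarrow> in_Lp 1 chi \<longrightarrow>
             (\<forall>(u::real) (w::real). u \<noteq> w \<longrightarrow>
                basic_L1_bound \<alpha> \<rho> \<phi> \<psi> chi u w
                  (inverse (C_adm \<phi>) * C p \<rho> * \<bar>u - w\<bar> powr (- \<rho>)
                     * Lp_norm q \<psi> * Lp_norm p \<phi> * Lp_norm 1 chi)))
       \<and>
         (\<forall>(\<rho>::real) (\<alpha>::real)
             (\<phi> :: real \<Rightarrow> complex) (\<psi> :: real \<Rightarrow> complex) (chi :: real \<Rightarrow> complex).
             sin (\<alpha> * pi / 2) \<noteq> 0 \<longrightarrow>
             in_Lp 2 \<phi> \<longrightarrow> admissible \<phi> \<longrightarrow>
             1 \<le> \<rho> \<longrightarrow>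
             in_Lp 1 chi \<longrightarrow>
             in_Lp 1 (\<lambda>x. of_real (1 + \<bar>x\<bar> powr (\<rho> - 1)) * \<phi> x) \<longrightarrow>
             in_Lp 1 (\<lambda>x. of_real (1 + \<bar>x\<bar> powr (\<rho> - 1)) * \<psi> x) \<longrightarrow>
             (\<forall>(u::real) (w::real). u \<noteq> w \<longrightarrow>
                basic_L1_bound \<alpha> \<rho> \<phi> \<psi> chi u w
                  (inverse (C_adm \<phi>) * 2 powr (\<rho> - 1) * \<bar>u - w\<bar> powr (- \<rho>)
                     * (Lp_norm 1 (\<lambda>x. \<psi> x * of_real (\<bar>x\<bar> powr (\<rho> - 1))) * Lp_norm 1 \<phi>
                        + Lp_norm 1 (\<lambda>x. \<phi> x * of_real (\<bar>x\<bar> powr (\<rho> - 1))) * Lp_norm 1 \<psi>)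
                     * Lp_norm 1 chi)))"
proof (intro conjI exI[of _ "\<lambda>p \<rho>. hls_const p \<rho> + hls_const (1 / (1 + \<rho> - 1 / p)) \<rho>"] allI impI)
  fix p q \<rho> \<alpha> :: real and \<phi> \<psi> chi :: "real \<Rightarrow> complex" and u w :: real
  assume adm: "admissible \<phi>" and pq: "1 < p" "1 < q" "0 < \<rho>" "1 / p + 1 / q = 1 + \<rho>"
    and psi: "in_Lp q \<psi>" and phi: "in_Lp p \<phi>" and chi: "in_Lp 1 chi" and uw: "u \<noteq> w"
  have [measurable]: "\<phi> \<in> borel_measurable borel" "\<psi> \<in> borel_measurable borel"
    using phi psi by (simp_all add: in_Lp_def)
  \<comment> \<open>The constant may depend only on \<open>p\<close> and \<rho>, so the witness
    contains \<open>q\<close> in the form given by solving the exponent relation for it.\<close>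
  have "1 + \<rho> - 1 / p = 1 / q" using pq by simp
  then have q: "1 / (1 + \<rho> - 1 / p) = q" by simp
  define K where "K = (hls_const p \<rho> + hls_const q \<rho>) * Lp_norm q \<psi> * Lp_norm p \<phi>"
  have "K \<ge> 0"
    using pq sobolev_exponent_less_1[of p q \<rho>] sobolev_exponent_less_1[of q p \<rho>]
    by (simp add: K_def hls_const_nonneg Lp_norm_nonneg add.commute)
  moreover have "(\<integral>\<^sup>+x. (\<integral>\<^sup>+y. ennreal (cmod (\<psi> x) * cmod (\<phi> y) * \<bar>y - x\<bar> powr (\<rho> - 1)) \<partial>lborel) \<partial>lborel) \<le> ennreal K"
    unfolding K_def
    by (rule hardy_littlewood_sobolev)
       (use pq psi phi in \<open>auto simp: Lp_norm_nonneg nn_integral_Lp_norm\<close>)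
  ultimately show "basic_L1_bound \<alpha> \<rho> \<phi> \<psi> chi u w
      (inverse (C_adm \<phi>) * (hls_const p \<rho> + hls_const (1 / (1 + \<rho> - 1 / p)) \<rho>) * \<bar>u - w\<bar> powr (- \<rho>)
        * Lp_norm q \<psi> * Lp_norm p \<phi> * Lp_norm 1 chi)"
    using basic_L1_bound_if_kernel_bound[of \<phi> \<psi> chi u w K \<rho> \<alpha>] adm chi uw
    unfolding q by (simp add: K_def mult_ac)
next
  fix \<rho> \<alpha> :: real and \<phi> \<psi> chi :: "real \<Rightarrow> complex" and u w :: real
  assume adm: "admissible \<phi>" and rho: "1 \<le> \<rho>" and chi: "in_Lp 1 chi" and uw: "u \<noteq> w"
    and phi: "in_Lp 1 (\<lambda>x. of_real (1 + \<bar>x\<bar> powr (\<rho> - 1)) * \<phi> x)"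
    and psi: "in_Lp 1 (\<lambda>x. of_real (1 + \<bar>x\<bar> powr (\<rho> - 1)) * \<psi> x)"
  note phi = integrable_weightedD[OF phi] and psi = integrable_weightedD[OF psi]
  define K where "K = 2 powr (\<rho> - 1) * (Lp_norm 1 (\<lambda>x. \<psi> x * of_real (\<bar>x\<bar> powr (\<rho> - 1))) * Lp_norm 1 \<phi>
      + Lp_norm 1 (\<lambda>x. \<phi> x * of_real (\<bar>x\<bar> powr (\<rho> - 1))) * Lp_norm 1 \<psi>)"
  have "K \<ge> 0" by (simp add: K_def Lp_norm_nonneg)
  then have "basic_L1_bound \<alpha> \<rho> \<phi> \<psi> chi u w (inverse (C_adm \<phi>) * \<bar>u - w\<bar> powr (- \<rho>) * K * Lp_norm 1 chi)"
    using phi(1) psi(1) chi adm uw weighted_kernel_bound[OF rho psi phi]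
    by (intro basic_L1_bound_if_kernel_bound) (auto simp: K_def dest: borel_measurable_integrable)
  then show "basic_L1_bound \<alpha> \<rho> \<phi> \<psi> chi u w
      (inverse (C_adm \<phi>) * 2 powr (\<rho> - 1) * \<bar>u - w\<bar> powr (- \<rho>)
        * (Lp_norm 1 (\<lambda>x. \<psi> x * of_real (\<bar>x\<bar> powr (\<rho> - 1))) * Lp_norm 1 \<phi>
          + Lp_norm 1 (\<lambda>x. \<phi> x * of_real (\<bar>x\<bar> powr (\<rho> - 1))) * Lp_norm 1 \<psi>)
        * Lp_norm 1 chi)"
    by (simp add: K_def mult_ac)
qed

end
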